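(* Let $q,a,b$ be nonzero real numbers with $q\neq\pm1$, and suppose $b\neq q^{-j}$ and $a^{-1}b\neq q^{j}$ for every integer $j\ge 0$. Define operators on real polynomials $f(x)$ by $$X f(x)=(x-q)f(q^{-1}x)+(q-bx)f(x),\qquad Z f(x)=(1-qx^{-1})f(q^{-1}x)+(qx^{-1}-b)f(x),$$ so that $Z=x^{-1}X$, and let $$P_n(x)=\frac{(a^{-1}bq^{1-n};q)_n(q;q)_n}{(q^{-n};q)_n(b;q)_n}\;{}_2\phi_1\!\left({q^{-n},\,b\atop a^{-1}bq^{1-n}};q,x\right),\qquad n\ge0,$$ be the Pastro polynomials. Then for every integer $n\ge 0$, $$XP_n(x)=q^{-n}(1-bq^{n})P_{n+1}(x)+q(1-a^{-1}bq^{-n})P_n(x),$$ $$ZP_n(x)=q^{-n}(1-bq^{n})P_{n}(x)+\frac{bq(1-q^{-n})(1-aq^{n-1})}{a(1-bq^{n-1})}P_{n-1}(x),$$ and consequently the relation $XP_n=x\,ZP_n$ is the three-term recurrence relation $$P_{n+1}(x)+\mu_n^{(1)}P_n(x)=x\left(P_n(x)+\mu_n^{(2)}P_{n-1}(x)\right),$$ with $$\mu_n^{(1)}=-\frac{q(b-aq^n)}{a(1-bq^n)},\qquad \mu_n^{(2)}=-\frac{bq(1-q^n)(1-aq^{n-1})}{a(1-bq^n)(1-bq^{n-1})}.$$ For $n=0$ the terms containing $P_{-1}$ are absent (taken to be $0$).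
   Context: The $q$-Pochhammer symbol is $(z;q)_0=1$, $(z;q)_k=\prod_{i=0}^{k-1}(1-zq^i)$ for $k\ge1$. The terminating $q$-hypergeometric series is $${}_2\phi_1\!\left({q^{-n},\beta\atop \gamma};q,x\right)=\sum_{k=0}^{n}\frac{(q^{-n};q)_k(\beta;q)_k}{(\gamma;q)_k(q;q)_k}x^k .$$ The operator $Z$ maps polynomials to polynomials, since $Zx^n=(q^{-n}-b)x^n+q(1-q^{-n})x^{n-1}$. *)

theory Defs
  imports Complex_Main "HOL-Computational_Algebra.Polynomial"
begin

definition qpoch :: "real \<Rightarrow> real \<Rightarrow> nat \<Rightarrow> real" where
  "qpoch z q k = (\<Prod>i<k. 1 - z * q ^ i)"

text \<open>The terminating series with upper parameters \<open>q\<^sup>-\<^sup>n, \<beta>\<close> and lower parameter \<open>\<gamma>\<close>,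
  as a polynomial in its argument \<open>x\<close>.\<close>

definition qphi21 :: "real \<Rightarrow> nat \<Rightarrow> real \<Rightarrow> real \<Rightarrow> real poly" where
  "qphi21 q n \<beta> \<gamma> =
     (\<Sum>k\<le>n. monom (qpoch (q powi (- int n)) q k * qpoch \<beta> q k / (qpoch \<gamma> q k * qpoch q q k)) k)"

lemma poly_qphi21:
  "poly (qphi21 q n \<beta> \<gamma>) x =
     (\<Sum>k\<le>n. qpoch (q powi (- int n)) q k * qpoch \<beta> q k / (qpoch \<gamma> q k * qpoch q q k) * x ^ k)"
  by (simp add: qphi21_def poly_sum poly_monom)

definition pastro :: "real \<Rightarrow> real \<Rightarrow> real \<Rightarrow> nat \<Rightarrow> real poly" where
  "pastro q a b n =
     smult (qpoch (inverse a * b * q powi (1 - int n)) q n * qpoch q q n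
              / (qpoch (q powi (- int n)) q n * qpoch b q n))
           (qphi21 q n b (inverse a * b * q powi (1 - int n)))"

text \<open>The predecessor \<open>P\<^bsub>n-1\<^esub>\<close>, with the convention that it is \<open>0\<close> for \<open>n = 0\<close>.\<close>

definition pastro_pred :: "real \<Rightarrow> real \<Rightarrow> real \<Rightarrow> nat \<Rightarrow> real poly" where
  "pastro_pred q a b n = (if n = 0 then 0 else pastro q a b (n - 1))"

definition X_op :: "real \<Rightarrow> real \<Rightarrow> real poly \<Rightarrow> real poly" where
  "X_op q b f = [:- q, 1:] * pcompose f [:0, inverse q:] + [:q, - b:] * f"

text \<open>The formula for \<open>Z f\<close> involves \<open>x\<^sup>-\<^sup>1\<close>, so it only makes sense for \<open>x \<noteq> 0\<close>;
  \<open>Z f\<close> is the polynomial that agrees with it there (see \<open>poly_Z_op\<close>).\<close>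

definition Z_op :: "real \<Rightarrow> real \<Rightarrow> real poly \<Rightarrow> real poly" where
  "Z_op q b f = (THE g. \<forall>x. x \<noteq> 0 \<longrightarrow>
     poly g x = (1 - q * inverse x) * poly f (inverse q * x) + (q * inverse x - b) * poly f x)"

lemma poly_X_op:
  "poly (X_op q b f) x = (x - q) * poly f (inverse q * x) + (q - b * x) * poly f x"
  by (simp add: X_op_def poly_pcompose algebra_simps)

lemma Z_op_ex1:
  fixes q b :: real and f :: "real poly"
  shows "\<exists>!g. \<forall>x. x \<noteq> 0 \<longrightarrow>
     poly g x = (1 - q * inverse x) * poly f (inverse q * x) + (q * inverse x - b) * poly f x"
proof (rule ex_ex1I)
  have "poly (X_op q b f) 0 = 0"
    by (simp add: poly_X_op)
  then obtain g where g: "X_op q b f = [:0, 1:] * g"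
    by (auto simp: poly_eq_0_iff_dvd dvd_def)
  have "poly g x = (1 - q * inverse x) * poly f (inverse q * x) + (q * inverse x - b) * poly f x"
    if "x \<noteq> 0" for x
  proof -
    have "x * poly g x = (x - q) * poly f (inverse q * x) + (q - b * x) * poly f x"
      using g poly_X_op[of q b f x] by simp
    also have "\<dots> = (x - q * (x * inverse x)) * poly f (inverse q * x)
                       + (q * (x * inverse x) - b * x) * poly f x"
      using that by simp
    also have "\<dots> = x * ((1 - q * inverse x) * poly f (inverse q * x)
                        + (q * inverse x - b) * poly f x)"
      by (simp only: algebra_simps)
    finally show ?thesis
      using that by simp
  qed
  then show "\<exists>g. \<forall>x. x \<noteq> 0 \<longrightarrow>
     poly g x = (1 - q * inverse x) * poly f (inverse q * x) + (q * inverse x - b) * poly f x"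
    by blast
next
  fix g h :: "real poly"
  assume
    "\<forall>x. x \<noteq> 0 \<longrightarrow>
       poly g x = (1 - q * inverse x) * poly f (inverse q * x) + (q * inverse x - b) * poly f x"
    "\<forall>x. x \<noteq> 0 \<longrightarrow>
       poly h x = (1 - q * inverse x) * poly f (inverse q * x) + (q * inverse x - b) * poly f x"
  then have "poly ([:0, 1:] * g) x = poly ([:0, 1:] * h) x" for x
    by (cases "x = 0") auto
  then have "[:0, 1:] * g = [:0, 1:] * h"
    by (simp add: poly_eq_poly_eq_iff[symmetric] fun_eq_iff)
  then show "g = h"
    by (metis mult_left_cancel one_neq_zero pCons_eq_0_iff)
qed

lemma poly_Z_op:
  "x \<noteq> 0 \<Longrightarrow> poly (Z_op q b f) x =
     (1 - q * inverse x) * poly f (inverse q * x) + (q * inverse x - b) * poly f x"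
  using theI'[OF Z_op_ex1[of q f b]] unfolding Z_op_def by blast

definition mu1 :: "real \<Rightarrow> real \<Rightarrow> real \<Rightarrow> nat \<Rightarrow> real" where
  "mu1 q a b n = - (q * (b - a * q ^ n) / (a * (1 - b * q ^ n)))"

definition mu2 :: "real \<Rightarrow> real \<Rightarrow> real \<Rightarrow> nat \<Rightarrow> real" where
  "mu2 q a b n =
     - (b * q * (1 - q ^ n) * (1 - a * q powi (int n - 1))
        / (a * (1 - b * q ^ n) * (1 - b * q powi (int n - 1))))"

end

theory Submission
  imports Defs
begin

text \<open>Reversing the products in \<open>(\<gamma>;q)\<^sub>n / (\<gamma>;q)\<^sub>k\<close> and \<open>(q\<^sup>-\<^sup>n;q)\<^sub>n / (q\<^sup>-\<^sup>n;q)\<^sub>k\<close>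
  leaves quotients that depend on \<open>n - k\<close> only. So the coefficient of \<open>x\<^sup>k\<close> in \<open>P\<^sub>n\<close> factors as
  \<open>u (n - k) * w n / w k\<close>, where \<open>u\<close> and \<open>w\<close> satisfy first-order recurrences. Both operators are
  two-banded on monomials, so each relation becomes an identity of rational functions between
  neighbouring coefficients.\<close>

section \<open>q-Pochhammer products and their reversal\<close>

lemma qpoch_0 [simp]: "qpoch z q 0 = 1"
  by (simp add: qpoch_def)

lemma qpoch_Suc: "qpoch z q (Suc k) = qpoch z q k * (1 - z * q ^ k)"
  by (simp add: qpoch_def)

lemma qpoch_add: "qpoch z q (k + m) = qpoch z q k * qpoch (z * q ^ k) q m"
  by (induction m) (simp_all add: qpoch_Suc power_add mult.assoc)

lemma qpoch_nonzero:
  assumes "\<And>i. i < k \<Longrightarrow> z * q ^ i \<noteq> 1"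
  shows "qpoch z q k \<noteq> 0"
  using assms by (auto simp: qpoch_def)

text \<open>Read from the last factor to the first, the product has factors 1 - e q^(-i). Passing to
  base 1/q thus removes the length \<open>m\<close> from the parameter.\<close>

lemma qpoch_reverse:
  assumes "q \<noteq> 0"
  shows "qpoch (e * q powi (1 - int m)) q m = qpoch e (inverse q) m"
proof -
  have "e * q powi (1 - int m) * q ^ (m - Suc i) = e * inverse q ^ i" if "i < m" for i
  proof -
    have "q powi (1 - int m) * q ^ (m - Suc i) = q powi (1 - int m + int (m - Suc i))"
      using assms by (simp add: power_int_add)
    also have "1 - int m + int (m - Suc i) = - int i"
      using that by simp
    also have "q powi (- int i) = inverse q ^ i"
      by (simp add: power_int_minus power_inverse)
    finally show ?thesis
      by simp
  qed
  then show ?thesis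
    unfolding qpoch_def
    by (subst prod.nat_diff_reindex[symmetric]) (intro prod.cong refl, simp only: lessThan_iff)
qed

text \<open>|q|^n = 1 with n > 0 forces |q| = 1, so excluding 1 and -1 excludes every real root of
  unity. This keeps (q;q)_n and (1/q;1/q)_n nonzero.\<close>

lemma power_eq_1_real:
  fixes q :: real
  assumes "q \<noteq> 1" "q \<noteq> - 1" "q ^ n = 1"
  shows "n = 0"
proof (rule ccontr)
  assume "n \<noteq> 0"
  moreover have "\<bar>q\<bar> ^ n = 1"
    using assms(3) by (simp flip: power_abs)
  ultimately have "\<bar>q\<bar> = 1"
    by (metis abs_ge_zero power_eq_iff_eq_base power_one zero_le_one neq0_conv)
  with assms show False
    by linarith
qed

section \<open>The two operators on coefficients\<close>

lemma coeff_X_op_0: "coeff (X_op q b f) 0 = 0"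
  using poly_X_op[of q b f 0] by (simp add: poly_0_coeff_0)

lemma coeff_X_op_Suc:
  "coeff (X_op q b f) (Suc k) =
     (inverse q ^ k - b) * coeff f k + q * (1 - inverse q ^ Suc k) * coeff f (Suc k)"
  by (simp add: X_op_def coeff_pcompose_linear algebra_simps)

lemma X_op_eq_Z_op: "X_op q b f = [:0, 1:] * Z_op q b f"
proof -
  have "poly (X_op q b f) x = poly ([:0, 1:] * Z_op q b f) x" for x
    \<comment> \<open>\<open>poly_Z_op\<close> says nothing at 0. There the factor x annihilates the
      right side, and the left side is -q f(0) + q f(0).\<close>
    by (cases "x = 0") (simp_all add: poly_X_op poly_Z_op field_simps)
  then show ?thesis
    by (simp add: poly_eq_poly_eq_iff[symmetric] fun_eq_iff)
qed

lemma coeff_Z_op: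
  "coeff (Z_op q b f) k =
     (inverse q ^ k - b) * coeff f k + q * (1 - inverse q ^ Suc k) * coeff f (Suc k)"
  using coeff_X_op_Suc[of q b f k] by (simp add: X_op_eq_Z_op)

section \<open>Closed form of the coefficients of the Pastro polynomials\<close>

locale pastro_parameters =
  fixes q a b :: real
  assumes q_nonzero: "q \<noteq> 0" and a_nonzero: "a \<noteq> 0"
    and q_neq_1: "q \<noteq> 1" and q_neq_m1: "q \<noteq> - 1"
    and b_neq: "\<And>j::nat. b \<noteq> q powi (- int j)"
    and ab_neq: "\<And>j::nat. inverse a * b \<noteq> q ^ j"
begin

lemma q_power_neq_1: "q ^ Suc n \<noteq> 1"
  using power_eq_1_real[OF q_neq_1 q_neq_m1] by blast

lemma b_power_neq_1: "b * q ^ n \<noteq> 1"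
  using b_neq[of n] q_nonzero by (auto simp: power_int_minus field_simps)

text \<open>With m = n - k, this is the quotient of what remains of (b q^(1-n)/a; q)_n and of
  (q^(-n); q)_n after their first k factors.\<close>

definition u :: "nat \<Rightarrow> real" where
  "u m = qpoch (inverse a * b) (inverse q) m / qpoch (inverse q) (inverse q) m"

definition w :: "nat \<Rightarrow> real" where
  "w n = qpoch q q n / qpoch b q n"

lemma qpoch_q_nonzero: "qpoch q q n \<noteq> 0"
  using q_power_neq_1 by (intro qpoch_nonzero) simp

lemma qpoch_b_nonzero: "qpoch b q n \<noteq> 0"
  using b_power_neq_1 by (intro qpoch_nonzero) simp

lemma qpoch_inverse_q_nonzero: "qpoch (inverse q) (inverse q) n \<noteq> 0"
proof (rule qpoch_nonzero)
  fix i
  show "inverse q * inverse q ^ i \<noteq> 1"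
    using q_power_neq_1[of i] q_nonzero by (auto simp: power_inverse field_simps)
qed

text \<open>By \<open>qpoch_reverse\<close> this is (b q^(1-n)/a; q)_n, so \<open>ab_neq\<close> is
  what keeps the denominators of the series away from 0.\<close>

lemma qpoch_ab_nonzero: "qpoch (inverse a * b) (inverse q) n \<noteq> 0"
proof (rule qpoch_nonzero)
  fix i
  show "inverse a * b * inverse q ^ i \<noteq> 1"
    using ab_neq[of i] q_nonzero by (auto simp: power_inverse field_simps)
qed

lemma w_nonzero: "w n \<noteq> 0"
  using qpoch_q_nonzero qpoch_b_nonzero by (simp add: w_def)

lemma u_0: "u 0 = 1"
  by (simp add: u_def)

lemma u_Suc: "u (Suc m) = u m * ((1 - b / a / q ^ m) / (1 - 1 / (q * q ^ m)))"
  by (simp add: u_def qpoch_Suc divide_simps)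

lemma w_Suc: "w (Suc n) = w n * ((1 - q * q ^ n) / (1 - b * q ^ n))"
  by (simp add: w_def qpoch_Suc)

lemma qpoch_shift_split:
  assumes "k \<le> n"
  shows "qpoch (e * q powi (1 - int n)) q n =
           qpoch (e * q powi (1 - int n)) q k * qpoch e (inverse q) (n - k)"
proof -
  have "q powi (1 - int n) * q ^ k = q powi (1 - int n + int k)"
    using q_nonzero by (simp add: power_int_add)
  also have "1 - int n + int k = 1 - int (n - k)"
    using assms by simp
  finally have "e * q powi (1 - int n) * q ^ k = e * q powi (1 - int (n - k))"
    by simp
  then have "qpoch (e * q powi (1 - int n) * q ^ k) q (n - k) = qpoch e (inverse q) (n - k)"
    by (simp only: qpoch_reverse[OF q_nonzero])
  then show ?thesis
    using qpoch_add[of "e * q powi (1 - int n)" q k "n - k"] assms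
    by simp
qed

lemma coeff_pastro:
  "coeff (pastro q a b n) k = (if k \<le> n then u (n - k) * w n / w k else 0)"
proof (cases "k \<le> n")
  case True
  let ?g = "inverse a * b * q powi (1 - int n)" and ?h = "inverse q * q powi (1 - int n)"
  \<comment> \<open>In this form the upper parameter, too, is some e times q^(1-n), here with e =
    1/q, so \<open>qpoch_shift_split\<close> serves both parameters.\<close>
  have h: "q powi (- int n) = ?h"
    using q_nonzero power_int_add[of q "- 1" "1 - int n"] by (simp add: power_int_minus)
  note g_split = qpoch_shift_split[OF True, of "inverse a * b"]
    and h_split = qpoch_shift_split[OF True, of "inverse q"]
  have "qpoch ?g q n \<noteq> 0" "qpoch ?h q n \<noteq> 0"
    using qpoch_reverse[OF q_nonzero] qpoch_ab_nonzero qpoch_inverse_q_nonzero by simp_all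
  \<comment> \<open>The first k factors divide the full product, so they inherit its nonvanishing
    and may be cancelled.\<close>
  then have nz: "qpoch ?g q k \<noteq> 0" "qpoch ?h q k \<noteq> 0"
    using g_split h_split by auto
  have "coeff (pastro q a b n) k =
      qpoch ?g q n * qpoch q q n / (qpoch ?h q n * qpoch b q n)
      * (qpoch ?h q k * qpoch b q k / (qpoch ?g q k * qpoch q q k))"
    using True by (simp add: pastro_def qphi21_def h coeff_sum)
  also have "\<dots> = u (n - k) * w n / w k"
    unfolding g_split h_split u_def w_def
    using nz qpoch_q_nonzero qpoch_b_nonzero qpoch_inverse_q_nonzero by (simp add: divide_simps)
  finally show ?thesis
    using True by simp
next
  case False
  then show ?thesis
    by (simp add: pastro_def qphi21_def coeff_sum)
qed

section \<open>The two structure relations\<close>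

lemma X_op_pastro:
  "X_op q b (pastro q a b n) =
     smult (q powi (- int n) * (1 - b * q ^ n)) (pastro q a b (Suc n))
     + smult (q * (1 - inverse a * b * q powi (- int n))) (pastro q a b n)"
proof (rule poly_eqI)
  fix k
  have p: "q powi (- int n) = 1 / q ^ n"
    by (simp add: power_int_minus divide_inverse)
  show "coeff (X_op q b (pastro q a b n)) k =
      coeff (smult (q powi (- int n) * (1 - b * q ^ n)) (pastro q a b (Suc n))
        + smult (q * (1 - inverse a * b * q powi (- int n))) (pastro q a b n)) k"
  proof (cases k)
    case 0
    \<comment> \<open>The left side has no constant term. On the right the two constant terms
      cancel, because (1 - q^(n+1)) / (1 - q^(-n-1)) = -q^(n+1).\<close>
    have "1 - b * q ^ n \<noteq> 0" "1 - q * q ^ n \<noteq> 0"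
      using b_power_neq_1[of n] q_power_neq_1[of n] by auto
    then show ?thesis
      using 0 q_nonzero a_nonzero w_nonzero[of 0] q_power_neq_1[of n]
      by (simp add: coeff_X_op_0 coeff_pastro p u_Suc w_Suc divide_simps) (simp add: algebra_simps)
  next
    case (Suc j)
    consider "j < n" | "j = n" | "j > n" by linarith
    then show ?thesis
    proof cases
      case 1
      \<comment> \<open>Writing n = j + m + 1 turns everything into a rational function of q^j and
        q^m, which are treated as independent quantities.\<close>
      then obtain m where n: "n = Suc (j + m)"
        using less_iff_Suc_add by auto
      have nz: "1 - b * q ^ j \<noteq> 0" "1 - b * q ^ n \<noteq> 0"
          "1 - q * q ^ j \<noteq> 0" "1 - q * q ^ m \<noteq> 0" "q * q ^ m \<noteq> 1"
        using b_power_neq_1[of n] b_power_neq_1[of j] q_power_neq_1[of j] q_power_neq_1[of m] by auto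
      have "n - j = Suc m" "n - Suc j = m" "q ^ n = q * (q ^ j * q ^ m)"
        by (simp_all add: n power_add)
      \<comment> \<open>The divisor is 1 - b q^n. Both \<open>w n\<close> and
        \<open>w (Suc n)\<close> are then polynomial multiples of \<open>c\<close>, which drops out
        of the identity.\<close>
      moreover define c where "c = w n / (1 - b * (q * (q ^ j * q ^ m)))"
      moreover have "w n = c * (1 - b * (q * (q ^ j * q ^ m)))"
          "w (Suc n) = c * (1 - q * (q * (q ^ j * q ^ m)))"
        using nz calculation by (simp_all add: w_Suc)
      ultimately show ?thesis
        using 1 Suc q_nonzero a_nonzero w_nonzero[of j] nz
        by (simp add: coeff_X_op_Suc coeff_pastro p u_Suc w_Suc[of j] power_inverse divide_simps)
          (simp add: algebra_simps)
    next
      \<comment> \<open>Top degree n + 1: only P_(n+1) contributes on the right, and all P_n are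
        monic since \<open>u 0\<close> is 1.\<close>
      case 2
      then show ?thesis
        using Suc q_nonzero w_nonzero by (simp add: coeff_X_op_Suc coeff_pastro p u_0 field_simps)
    next
      case 3
      then show ?thesis
        using Suc by (simp add: coeff_X_op_Suc coeff_pastro)
    qed
  qed
qed

lemma Z_op_pastro:
  "Z_op q b (pastro q a b n) =
     smult (q powi (- int n) * (1 - b * q ^ n)) (pastro q a b n)
     + smult (b * q * (1 - q powi (- int n)) * (1 - a * q powi (int n - 1))
                / (a * (1 - b * q powi (int n - 1)))) (pastro_pred q a b n)"
proof (cases n)
  case 0
  show ?thesis
    by (rule poly_eqI) (auto simp: 0 coeff_Z_op coeff_pastro pastro_pred_def algebra_simps)
next
  case (Suc l)
  have p: "q powi (- int n) = 1 / q ^ n"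
    by (simp add: power_int_minus divide_inverse)
  have p': "q powi (int n - 1) = q ^ l"
    by (simp add: Suc)
  have pred: "pastro_pred q a b n = pastro q a b l" and l_less: "l < n"
    by (simp_all add: pastro_pred_def Suc)
  show ?thesis
  proof (rule poly_eqI)
    fix k
    consider "k < n" | "k = n" | "k > n" by linarith
    then show "coeff (Z_op q b (pastro q a b n)) k =
        coeff (smult (q powi (- int n) * (1 - b * q ^ n)) (pastro q a b n)
          + smult (b * q * (1 - q powi (- int n)) * (1 - a * q powi (int n - 1))
                / (a * (1 - b * q powi (int n - 1)))) (pastro_pred q a b n)) k"
    proof cases
      case 1
      then obtain m where n: "n = Suc (k + m)"
        using less_iff_Suc_add by auto
      have nz: "1 - b * q ^ k \<noteq> 0" "1 - b * q ^ l \<noteq> 0"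
          "1 - q * q ^ k \<noteq> 0" "1 - q * q ^ m \<noteq> 0" "q * q ^ m \<noteq> 1"
        using b_power_neq_1[of l] b_power_neq_1[of k] q_power_neq_1[of k] q_power_neq_1[of m] by auto
      have "n - k = Suc m" "n - Suc k = m" "l - k = m" "q ^ n = q * (q ^ k * q ^ m)"
          "q ^ l = q ^ k * q ^ m" "k \<le> l"
        using Suc n by (auto simp: power_add)
      \<comment> \<open>As before, now with n - 1 = l = k + m: the divisor is 1 - b q^l, and
        \<open>w l\<close> and \<open>w n\<close> are polynomial multiples of
        \<open>c\<close>.\<close>
      moreover define c where "c = w l / (1 - b * (q ^ k * q ^ m))"
      moreover have "w l = c * (1 - b * (q ^ k * q ^ m))" "w n = c * (1 - q * (q ^ k * q ^ m))"
        using nz calculation by (simp_all add: Suc w_Suc)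
      ultimately show ?thesis
        using 1 q_nonzero a_nonzero w_nonzero[of k] nz
        by (simp add: coeff_Z_op coeff_pastro pred p p' u_Suc w_Suc[of k] power_inverse divide_simps)
          (simp add: algebra_simps)
    next
      \<comment> \<open>The term from degree n + 1 vanishes and P_(n-1) has no term of degree n, so
        only the leading coefficients of P_n are compared.\<close>
      case 2
      then show ?thesis
        using q_nonzero w_nonzero l_less
        by (simp add: coeff_Z_op coeff_pastro pred p u_0 field_simps)
    next
      case 3
      then show ?thesis
        using l_less by (simp add: coeff_Z_op coeff_pastro pred)
    qed
  qed
qed

end

text \<open>The conjunct with \<open>c\<close> makes "consequently" precise: the two sides of X P_n
  = x Z P_n are the same nonzero multiple of the two sides of the recurrence.\<close>

theorem mainTheorem3:
  fixes q a b :: real and n :: nat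
  assumes "q \<noteq> 0" and "a \<noteq> 0" and "b \<noteq> 0"
    and "q \<noteq> 1" and "q \<noteq> - 1"
    and "\<And>j::nat. b \<noteq> q powi (- int j)"
    and "\<And>j::nat. inverse a * b \<noteq> q ^ j"
  shows
    "(\<forall>f. X_op q b f = [:0, 1:] * Z_op q b f)
     \<and> X_op q b (pastro q a b n) =
         smult (q powi (- int n) * (1 - b * q ^ n)) (pastro q a b (Suc n))
         + smult (q * (1 - inverse a * b * q powi (- int n))) (pastro q a b n)
     \<and> Z_op q b (pastro q a b n) =
         smult (q powi (- int n) * (1 - b * q ^ n)) (pastro q a b n)
         + smult (b * q * (1 - q powi (- int n)) * (1 - a * q powi (int n - 1))
                    / (a * (1 - b * q powi (int n - 1)))) (pastro_pred q a b n)
     \<and> (\<exists>c. c \<noteq> 0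
         \<and> X_op q b (pastro q a b n) =
             smult c (pastro q a b (Suc n) + smult (mu1 q a b n) (pastro q a b n))
         \<and> [:0, 1:] * Z_op q b (pastro q a b n) =
             smult c ([:0, 1:] * (pastro q a b n + smult (mu2 q a b n) (pastro_pred q a b n))))
     \<and> pastro q a b (Suc n) + smult (mu1 q a b n) (pastro q a b n) =
         [:0, 1:] * (pastro q a b n + smult (mu2 q a b n) (pastro_pred q a b n))"
proof -
  interpret pastro_parameters q a b
    using assms by unfold_locales auto
  \<comment> \<open>The factor of P_(n+1) in X P_n equals the factor of P_n in Z P_n. Dividing the
    remaining coefficients by it produces \<open>mu1\<close> and \<open>mu2\<close>.\<close>
  define c where "c = q powi (- int n) * (1 - b * q ^ n)"
  have c: "c \<noteq> 0"
    using q_nonzero b_power_neq_1[of n] by (simp add: c_def)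
  have p: "q powi (- int n) = 1 / q ^ n"
    by (simp add: power_int_minus divide_inverse)
  have "q * (1 - inverse a * b * q powi (- int n)) = c * mu1 q a b n"
    using q_nonzero a_nonzero b_power_neq_1[of n]
    by (simp add: c_def mu1_def p divide_simps) (simp add: algebra_simps)
  then have X: "X_op q b (pastro q a b n) =
      smult c (pastro q a b (Suc n) + smult (mu1 q a b n) (pastro q a b n))"
    by (simp add: X_op_pastro c_def smult_add_right)
  \<comment> \<open>For \<open>n = 0\<close> the factor \<open>1 - b * q powi (int n - 1)\<close> may vanish, but the numerators are \<open>0\<close> then.\<close>
  have "b * q * (1 - q powi (- int n)) * (1 - a * q powi (int n - 1))
          / (a * (1 - b * q powi (int n - 1))) = c * mu2 q a b n"
    using q_nonzero a_nonzero b_power_neq_1[of n]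
    by (simp add: c_def mu2_def p divide_simps) (simp add: algebra_simps)
  then have Z: "Z_op q b (pastro q a b n) =
      smult c (pastro q a b n + smult (mu2 q a b n) (pastro_pred q a b n))"
    by (simp add: Z_op_pastro c_def smult_add_right)
  have Z': "[:0, 1:] * Z_op q b (pastro q a b n) =
      smult c ([:0, 1:] * (pastro q a b n + smult (mu2 q a b n) (pastro_pred q a b n)))"
    unfolding Z by (rule mult_smult_right)
  have "smult c (pastro q a b (Suc n) + smult (mu1 q a b n) (pastro q a b n)) =
      smult c ([:0, 1:] * (pastro q a b n + smult (mu2 q a b n) (pastro_pred q a b n)))"
    using X Z' X_op_eq_Z_op[of q b "pastro q a b n"] by simp
  then have "pastro q a b (Suc n) + smult (mu1 q a b n) (pastro q a b n) =
      [:0, 1:] * (pastro q a b n + smult (mu2 q a b n) (pastro_pred q a b n))"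
    using c by (metis smult_eq_iff)
  then show ?thesis
    using X_op_eq_Z_op X_op_pastro Z_op_pastro c X Z' by blast
qed

end
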